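(* Let $A_1,A_2$ be linearly independent complex $2\times 2$ matrices, and suppose that the pair $(A_1,A_2)$ is not simultaneously diagonalizable, in the sense that there do not exist $2\times 2$ unitary matrices $U,W$ such that $UA_1W$ and $UA_2W$ are both diagonal. Then there exist positive integers $p,q$ and $p\times q$ complex matrices $V_1,V_2$ such that the linear map $L_{\mathbf V}:(\mathbb C^2,\|\cdot\|_{\mathbf A}^* )\to(\mathcal M_{p,q}(\mathbb C),\|\cdot\|_{\rm op})$, $L_{\mathbf V}(w_1,w_2)=w_1V_1+w_2V_2$, is contractive but not completely contractive.
   Context: For $\mathbf A=(A_1,A_2)$, the norm $\|\cdot\|_{\mathbf A}$ on $\mathbb C^2$ is $\|(z_1,z_2)\|_{\mathbf A}=\|z_1A_1+z_2A_2\|_{\rm op}$, and $\Omega_{\mathbf A}$ is its open unit ball. The dual norm is $\|(w_1,w_2)\|_{\mathbf A}^*=\sup_{(z_1,z_2)\in\Omega_{\mathbf A}}|w_1z_1+w_2z_2|$. For $k\ge 1$ and $\Theta_1,\Theta_2\in\mathcal M_k(\mathbb C)$ put $\|(\Theta_1,\Theta_2)\|_{\mathbf A,k}^*=\sup_{(z_1,z_2)\in\Omega_{\mathbf A}}\|z_1\Theta_1+z_2\Theta_2\|_{\rm op}$, a norm on $\mathbb C^2\otimes\mathcal M_k$ (whose closed unit ball is the set of pairs $(\partial_1F(0),\partial_2F(0))$ with $F$ holomorphic from $\Omega_{\mathbf A}$ to the closed operator-norm unit ball of $\mathcal M_k$ and $F(0)=0$). Let $L_{\mathbf V}^{(k)}(\Theta_1,\Theta_2)=\Theta_1\otimes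 V_1+\Theta_2\otimes V_2\in\mathcal M_k\otimes\mathcal M_{p,q}$, the target carrying the operator norm. $L_{\mathbf V}$ is contractive if $\|L_{\mathbf V}(w)\|_{\rm op}\le\|w\|_{\mathbf A}^*$ for all $w$; it is completely contractive if $\|L_{\mathbf V}^{(k)}(\Theta_1,\Theta_2)\|_{\rm op}\le\|(\Theta_1,\Theta_2)\|_{\mathbf A,k}^*$ for all $k\ge1$ and all $\Theta_1,\Theta_2\in\mathcal M_k$. *)

theory Defs
  imports
    "HOL-Analysis.L2_Norm"
    "Jordan_Normal_Form.Schur_Decomposition"
begin

text \<open>
  Matrices are taken from the type \<open>complex mat\<close> with explicit dimensions, because the dimensions
  \<open>p\<close>, \<open>q\<close> and \<open>k\<close> below are quantified inside the statement.
\<close>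

definition unitary_mat :: "complex mat \<Rightarrow> bool" where
  "unitary_mat U \<longleftrightarrow> square_mat U \<and>
     U * mat_adjoint U = 1\<^sub>m (dim_row U) \<and> mat_adjoint U * U = 1\<^sub>m (dim_row U)"

text \<open>
  Not diagonalizability by a single similarity: \<open>U\<close> and \<open>W\<close> are independent unitaries.
\<close>
definition simultaneously_diagonalizable :: "nat \<Rightarrow> complex mat \<Rightarrow> complex mat \<Rightarrow> bool" where
  "simultaneously_diagonalizable n A1 A2 \<longleftrightarrow>
     (\<exists>U \<in> carrier_mat n n. \<exists>W \<in> carrier_mat n n. unitary_mat U \<and> unitary_mat W \<and>
        diagonal_mat (U * A1 * W) \<and> diagonal_mat (U * A2 * W))"

text \<open>
  Linear independence over the complex numbers of the pair (not of the set \<open>{A1, A2}\<close>, so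
  \<open>A1 = A2\<close> is excluded).
\<close>
definition lin_indpt_pair :: "nat \<Rightarrow> nat \<Rightarrow> complex mat \<Rightarrow> complex mat \<Rightarrow> bool" where
  "lin_indpt_pair m n A1 A2 \<longleftrightarrow>
     (\<forall>c1 c2. c1 \<cdot>\<^sub>m A1 + c2 \<cdot>\<^sub>m A2 = 0\<^sub>m m n \<longrightarrow> c1 = 0 \<and> c2 = 0)"

definition vec_norm2 :: "complex vec \<Rightarrow> real" where
  "vec_norm2 x = L2_set (\<lambda>i. cmod (x $ i)) {..<dim_vec x}"

definition op_norm :: "complex mat \<Rightarrow> real" where
  "op_norm M = (SUP x \<in> {x \<in> carrier_vec (dim_col M). vec_norm2 x \<le> 1}. vec_norm2 (M *\<^sub>v x))"

definition kronecker_mat :: "complex mat \<Rightarrow> complex mat \<Rightarrow> complex mat" (infixl \<open>\<otimes>\<^sub>k\<close> 70) where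
  "M \<otimes>\<^sub>k N = mat (dim_row M * dim_row N) (dim_col M * dim_col N)
     (\<lambda>(i, j). M $$ (i div dim_row N, j div dim_col N) * N $$ (i mod dim_row N, j mod dim_col N))"

definition pair_norm :: "complex mat \<Rightarrow> complex mat \<Rightarrow> complex \<times> complex \<Rightarrow> real" where
  "pair_norm A1 A2 = (\<lambda>(z1, z2). op_norm (z1 \<cdot>\<^sub>m A1 + z2 \<cdot>\<^sub>m A2))"

definition pair_ball :: "complex mat \<Rightarrow> complex mat \<Rightarrow> (complex \<times> complex) set" where
  "pair_ball A1 A2 = {z. pair_norm A1 A2 z < 1}"

text \<open>
  The suprema in the next two definitions are over bounded sets whenever \<open>A1\<close> and \<open>A2\<close> are
  linearly independent.
\<close>
definition dual_norm :: "complex mat \<Rightarrow> complex mat \<Rightarrow> complex \<times> complex \<Rightarrow> real" where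
  "dual_norm A1 A2 = (\<lambda>(w1, w2). SUP (z1, z2) \<in> pair_ball A1 A2. cmod (w1 * z1 + w2 * z2))"

definition mat_dual_norm ::
  "complex mat \<Rightarrow> complex mat \<Rightarrow> complex mat \<times> complex mat \<Rightarrow> real" where
  "mat_dual_norm A1 A2 =
     (\<lambda>(T1, T2). SUP (z1, z2) \<in> pair_ball A1 A2. op_norm (z1 \<cdot>\<^sub>m T1 + z2 \<cdot>\<^sub>m T2))"

definition lin_map :: "complex mat \<Rightarrow> complex mat \<Rightarrow> complex \<times> complex \<Rightarrow> complex mat" where
  "lin_map V1 V2 = (\<lambda>(w1, w2). w1 \<cdot>\<^sub>m V1 + w2 \<cdot>\<^sub>m V2)"

definition lin_map_ampl ::
  "complex mat \<Rightarrow> complex mat \<Rightarrow> complex mat \<times> complex mat \<Rightarrow> complex mat" where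
  "lin_map_ampl V1 V2 = (\<lambda>(T1, T2). T1 \<otimes>\<^sub>k V1 + T2 \<otimes>\<^sub>k V2)"

definition contractive ::
  "complex mat \<Rightarrow> complex mat \<Rightarrow> complex mat \<Rightarrow> complex mat \<Rightarrow> bool" where
  "contractive A1 A2 V1 V2 \<longleftrightarrow> (\<forall>w. op_norm (lin_map V1 V2 w) \<le> dual_norm A1 A2 w)"

definition completely_contractive ::
  "complex mat \<Rightarrow> complex mat \<Rightarrow> complex mat \<Rightarrow> complex mat \<Rightarrow> bool" where
  "completely_contractive A1 A2 V1 V2 \<longleftrightarrow>
     (\<forall>k\<ge>1. \<forall>T1 \<in> carrier_mat k k. \<forall>T2 \<in> carrier_mat k k.
        op_norm (lin_map_ampl V1 V2 (T1, T2)) \<le> mat_dual_norm A1 A2 (T1, T2))"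

end

(*
  Let m be the maximum of |v^T A1 u|^2 + |v^T A2 u|^2 over unit vectors u, v, and let c = m^(-1/2).
  Then the Euclidean ball of radius c lies in the closed unit ball of the norm of A, so both the
  column map w |-> c (w1, w2)^T and the row map w |-> c (w1, w2) are contractive. Suppose that both
  were completely contractive, and test them on Theta = A, whose matrix dual norm is at most 1.
  The column map gives |A1 u|^2 + |A2 u|^2 <= m, so at a maximizer (u, v) the vectors A1 u, A2 u have
  no component orthogonal to the conjugate of v; the row map gives the same for v^T A1, v^T A2 and u.
  Completing u and v to orthonormal bases thus diagonalizes A1 and A2 simultaneously.
*)
theory Submission
  imports Defs "HOL-Analysis.Topology_Euclidean_Space"
begin

unbundle no vec_syntax
hide_type (open) Finite_Cartesian_Product.vec
hide_const (open) Finite_Cartesian_Product.vec Finite_Cartesian_Product.mat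
  Finite_Cartesian_Product.row Finite_Cartesian_Product.column

section \<open>The operator norm\<close>

lemma vec_norm2_nonneg [simp]: "0 \<le> vec_norm2 x"
  by (simp add: vec_norm2_def)

lemma vec_norm2_power2: "(vec_norm2 x)\<^sup>2 = (\<Sum>i<dim_vec x. (cmod (x $ i))\<^sup>2)"
  by (simp add: vec_norm2_def L2_set_def sum_nonneg)

lemma vec_norm2_smult: "vec_norm2 (c \<cdot>\<^sub>v x) = cmod c * vec_norm2 x"
proof -
  have "vec_norm2 (c \<cdot>\<^sub>v x) = L2_set (\<lambda>i. cmod c * cmod (x $ i)) {..<dim_vec x}"
    unfolding vec_norm2_def by (rule L2_set_cong) (auto simp: norm_mult)
  then show ?thesis
    by (simp add: vec_norm2_def L2_set_right_distrib)
qed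

lemma cmod_le_vec_norm2: "i < dim_vec x \<Longrightarrow> cmod (x $ i) \<le> vec_norm2 x"
  unfolding vec_norm2_def by (rule member_le_L2_set) auto

lemma vec_norm2_eq_0_iff: "vec_norm2 x = 0 \<longleftrightarrow> x = 0\<^sub>v (dim_vec x)"
  by (auto simp: vec_norm2_def L2_set_eq_0_iff Matrix.vec_eq_iff)

lemma op_norm_le:
  assumes "\<And>x. x \<in> carrier_vec (dim_col M) \<Longrightarrow> vec_norm2 x \<le> 1 \<Longrightarrow> vec_norm2 (M *\<^sub>v x) \<le> b"
  shows "op_norm M \<le> b"
  unfolding op_norm_def
proof (rule cSUP_least)
  have "0\<^sub>v (dim_col M) \<in> {x \<in> carrier_vec (dim_col M). vec_norm2 x \<le> 1}"
    by (simp add: vec_norm2_def L2_set_def)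
  then show "{x \<in> carrier_vec (dim_col M). vec_norm2 x \<le> 1} \<noteq> {}" by blast
qed (use assms in auto)

text \<open>Every coordinate of a vector of norm at most 1 has modulus at most 1, so the sum of the
  moduli of all entries of \<open>M\<close> is a bound. Without a bound the real supremum in
  \<open>op_norm\<close> says nothing.\<close>

lemma bdd_above_op_norm:
  "bdd_above ((\<lambda>x. vec_norm2 (M *\<^sub>v x)) ` {x \<in> carrier_vec (dim_col M). vec_norm2 x \<le> 1})"
proof (rule bdd_aboveI2)
  fix x assume "x \<in> {x \<in> carrier_vec (dim_col M). vec_norm2 x \<le> 1}"
  then have x: "dim_vec x = dim_col M" "vec_norm2 x \<le> 1" by auto
  have "vec_norm2 (M *\<^sub>v x) \<le> (\<Sum>i<dim_row M. cmod ((M *\<^sub>v x) $ i))"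
    unfolding vec_norm2_def dim_mult_mat_vec by (rule L2_set_le_sum) simp
  also have "\<dots> \<le> (\<Sum>i<dim_row M. \<Sum>j<dim_col M. cmod (M $$ (i, j)))"
  proof (rule sum_mono)
    fix i assume i: "i \<in> {..<dim_row M}"
    have "cmod ((M *\<^sub>v x) $ i) = cmod (\<Sum>j<dim_col M. M $$ (i, j) * x $ j)"
      using i x by (simp add: scalar_prod_def atLeast0LessThan)
    also have "\<dots> \<le> (\<Sum>j<dim_col M. cmod (M $$ (i, j)) * cmod (x $ j))"
      by (rule sum_norm_le) (simp add: norm_mult)
    also have "\<dots> \<le> (\<Sum>j<dim_col M. cmod (M $$ (i, j)))"
    proof (rule sum_mono)
      fix j assume "j \<in> {..<dim_col M}"
      then have "cmod (x $ j) \<le> 1" using cmod_le_vec_norm2[of j x] x by simp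
      then show "cmod (M $$ (i, j)) * cmod (x $ j) \<le> cmod (M $$ (i, j))"
        by (simp add: mult_left_le)
    qed
    finally show "cmod ((M *\<^sub>v x) $ i) \<le> (\<Sum>j<dim_col M. cmod (M $$ (i, j)))" .
  qed
  finally show "vec_norm2 (M *\<^sub>v x) \<le> (\<Sum>i<dim_row M. \<Sum>j<dim_col M. cmod (M $$ (i, j)))" .
qed

lemma vec_norm2_mult_mat_vec_le:
  assumes x: "x \<in> carrier_vec (dim_col M)"
  shows "vec_norm2 (M *\<^sub>v x) \<le> op_norm M * vec_norm2 x"
proof (cases "vec_norm2 x = 0")
  case True
  then have "x = 0\<^sub>v (dim_col M)" using x by (simp add: vec_norm2_eq_0_iff)
  then have "M *\<^sub>v x = 0\<^sub>v (dim_row M)" by auto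
  then show ?thesis using True by (simp add: vec_norm2_def L2_set_def)
next
  case False
  define r where "r = vec_norm2 x"
  have r: "r > 0" using False unfolding r_def by (simp add: less_le)
  let ?y = "complex_of_real (1 / r) \<cdot>\<^sub>v x"
  have "vec_norm2 ?y = 1"
    using r by (simp add: vec_norm2_smult norm_divide flip: r_def)
  then have "vec_norm2 (M *\<^sub>v ?y) \<le> op_norm M"
    unfolding op_norm_def using x by (intro cSUP_upper bdd_above_op_norm) auto
  moreover have "M *\<^sub>v ?y = complex_of_real (1 / r) \<cdot>\<^sub>v (M *\<^sub>v x)"
    using mult_mat_vec[of M "dim_row M" "dim_col M" x] x by auto
  ultimately have "vec_norm2 (M *\<^sub>v x) / r \<le> op_norm M"
    using r by (simp add: vec_norm2_smult norm_divide)
  then show ?thesis using r by (simp add: field_simps flip: r_def)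
qed

text \<open>Apply \<open>M\<close> to the \<open>j\<close>-th unit vector and read off coordinate
  \<open>i\<close>. This later turns membership in \<open>pair_ball\<close> into bounds on
  entries.\<close>

lemma cmod_index_le_op_norm:
  assumes "i < dim_row M" "j < dim_col M"
  shows "cmod (M $$ (i, j)) \<le> op_norm M"
proof -
  let ?e = "unit_vec (dim_col M) j :: complex vec"
  have "(vec_norm2 ?e)\<^sup>2 = (\<Sum>i<dim_col M. if i = j then 1 else 0)"
    unfolding vec_norm2_power2 by (rule sum.cong) (auto simp: unit_vec_def)
  then have "(vec_norm2 ?e)\<^sup>2 = 1" using assms by simp
  then have e: "vec_norm2 ?e = 1" by (simp add: power2_eq_1_iff) (smt (verit) vec_norm2_nonneg)
  have "cmod ((M *\<^sub>v ?e) $ i) \<le> vec_norm2 (M *\<^sub>v ?e)"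
    using assms by (intro cmod_le_vec_norm2) simp
  also have "\<dots> \<le> op_norm M"
    using vec_norm2_mult_mat_vec_le[of ?e M] e by simp
  finally show ?thesis using assms by (simp add: scalar_prod_right_unit)
qed

section \<open>Maximizing the pairing of a pair of matrices\<close>

text \<open>Lagrange's identity. Dropping the second square leaves Cauchy-Schwarz; for a unit vector
  \<open>(a, b)\<close> it is Parseval's identity for the orthonormal basis \<open>(a, b)\<close>,
  \<open>(cnj b, - cnj a)\<close>. Both uses occur below.\<close>

lemma cmod_add_mult_power2:
  "(cmod (a * p + b * q))\<^sup>2 + (cmod (p * cnj b - q * cnj a))\<^sup>2 =
     ((cmod a)\<^sup>2 + (cmod b)\<^sup>2) * ((cmod p)\<^sup>2 + (cmod q)\<^sup>2)"
  unfolding cmod_power2 by (simp add: power2_eq_square algebra_simps)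

lemma cmod_add_mult_le:
  "(cmod (a * p + b * q))\<^sup>2 \<le> ((cmod a)\<^sup>2 + (cmod b)\<^sup>2) * ((cmod p)\<^sup>2 + (cmod q)\<^sup>2)"
  unfolding cmod_add_mult_power2[symmetric] by simp

text \<open>Vectors are pairs here because \<open>complex vec\<close> carries no topology.\<close>
definition bil :: "complex mat \<Rightarrow> complex \<times> complex \<Rightarrow> complex \<times> complex \<Rightarrow> complex" where
  "bil A u v = fst v * (A $$ (0, 0) * fst u + A $$ (0, 1) * snd u)
             + snd v * (A $$ (1, 0) * fst u + A $$ (1, 1) * snd u)"

definition bil_sq ::
  "complex mat \<Rightarrow> complex mat \<Rightarrow> complex \<times> complex \<Rightarrow> complex \<times> complex \<Rightarrow> real" where
  "bil_sq A1 A2 u v = (cmod (bil A1 u v))\<^sup>2 + (cmod (bil A2 u v))\<^sup>2"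

lemma bil_scaleR: "bil A (r *\<^sub>R u) (s *\<^sub>R v) = (of_real (r * s)) * bil A u v"
  by (simp add: bil_def algebra_simps scaleR_conv_of_real)

lemma bil_sq_scaleR: "bil_sq A1 A2 (r *\<^sub>R u) (s *\<^sub>R v) = (r * s)\<^sup>2 * bil_sq A1 A2 u v"
  by (simp add: bil_sq_def bil_scaleR norm_mult power_mult_distrib algebra_simps)

lemma norm_pair_power2: "(norm z)\<^sup>2 = (cmod (fst z))\<^sup>2 + (cmod (snd z))\<^sup>2"
  for z :: "complex \<times> complex"
  by (simp add: norm_prod_def)

text \<open>A continuous function on the compact product of two unit spheres attains its maximum;
  homogeneity of degree 2 in each argument carries the bound to all \<open>x\<close>,
  \<open>y\<close>.\<close>

lemma bil_sq_attains_max: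
  obtains u v where "norm u = 1" "norm v = 1"
    "\<And>x y. bil_sq A1 A2 x y \<le> bil_sq A1 A2 u v * (norm x)\<^sup>2 * (norm y)\<^sup>2"
proof -
  let ?S = "sphere 0 1 :: (complex \<times> complex) set"
  let ?f = "\<lambda>p. bil_sq A1 A2 (fst p) (snd p)"
  have ne: "(1, 0) \<in> ?S" by (simp add: norm_prod_def)
  have "compact (?S \<times> ?S)" by (intro compact_Times compact_sphere)
  moreover have "?S \<times> ?S \<noteq> {}" using ne by blast
  moreover have "continuous_on (?S \<times> ?S) ?f"
    unfolding bil_sq_def bil_def by (intro continuous_intros)
  ultimately obtain p where p: "p \<in> ?S \<times> ?S" and max: "\<And>q. q \<in> ?S \<times> ?S \<Longrightarrow> ?f q \<le> ?f p"
    using continuous_attains_sup[of "?S \<times> ?S" ?f] by blast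
  obtain u v where uv: "p = (u, v)" "norm u = 1" "norm v = 1"
    using p by (cases p) auto
  have "bil_sq A1 A2 x y \<le> bil_sq A1 A2 u v * (norm x)\<^sup>2 * (norm y)\<^sup>2" for x y
  proof (cases "x = 0 \<or> y = 0")
    \<comment> \<open>\<open>sgn 0 = 0\<close> is not on the sphere, but here both sides
      vanish.\<close>
    case True
    then show ?thesis by (auto simp: bil_sq_def bil_def)
  next
    case False
    then have "bil_sq A1 A2 (sgn x) (sgn y) \<le> bil_sq A1 A2 u v"
      using max[of "(sgn x, sgn y)"] uv by (simp add: norm_sgn)
    then have "bil_sq A1 A2 x y / ((norm x)\<^sup>2 * (norm y)\<^sup>2) \<le> bil_sq A1 A2 u v"
      by (simp add: sgn_div_norm bil_sq_scaleR field_simps)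
    then show ?thesis using False by (simp add: field_simps)
  qed
  with uv that show thesis by blast
qed

lemma sum_lessThan_2: "sum f {..<2} = f 0 + f 1"
  for f :: "nat \<Rightarrow> 'a::comm_monoid_add"
  by (simp add: numeral_2_eq_2)

lemma sum_lessThan_4: "sum f {..<4} = f 0 + f 1 + f 2 + f 3"
  for f :: "nat \<Rightarrow> 'a::comm_monoid_add"
  by (simp add: eval_nat_numeral)

lemma vec_norm2_dim2:
  "dim_vec x = 2 \<Longrightarrow> (vec_norm2 x)\<^sup>2 = (cmod (x $ 0))\<^sup>2 + (cmod (x $ 1))\<^sup>2"
  by (simp add: vec_norm2_power2 sum_lessThan_2)

text \<open>Pair the image \<open>y\<close> of \<open>x\<close> with its own conjugate
  \<open>Y\<close>. Cauchy-Schwarz in \<open>z\<close> and the bound on \<open>bil_sq\<close> give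
  |y|^4 \<le> |z|^2 m |x|^2 |y|^2, and |y|^2 cancels. With \<open>m\<close> the maximum, the
  Euclidean ball of radius m^(-1/2) lies in the closed unit ball of the norm.\<close>

lemma pair_norm_le:
  assumes A: "A1 \<in> carrier_mat 2 2" "A2 \<in> carrier_mat 2 2" and m: "0 \<le> m"
    and le: "\<And>x y. bil_sq A1 A2 x y \<le> m * (norm x)\<^sup>2 * (norm y)\<^sup>2"
  shows "pair_norm A1 A2 z \<le> sqrt m * norm z"
proof -
  obtain z1 z2 where z: "z = (z1, z2)" by fastforce
  have "op_norm (z1 \<cdot>\<^sub>m A1 + z2 \<cdot>\<^sub>m A2) \<le> sqrt m * norm z"
  proof (rule op_norm_le)
    fix x
    assume "x \<in> carrier_vec (dim_col (z1 \<cdot>\<^sub>m A1 + z2 \<cdot>\<^sub>m A2))" and x1: "vec_norm2 x \<le> 1"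
    then have x: "dim_vec x = 2" using A by simp
    define y where "y = (z1 \<cdot>\<^sub>m A1 + z2 \<cdot>\<^sub>m A2) *\<^sub>v x"
    define X where "X = (x $ 0, x $ 1)"
    \<comment> \<open>\<open>bil\<close> is bilinear, not sesquilinear, so the conjugates are what
      make the pairing of \<open>Y\<close> with \<open>y\<close> equal to |y|^2.\<close>
    define Y where "Y = (cnj (y $ 0), cnj (y $ 1))"
    define n where "n = vec_norm2 y"
    have y: "dim_vec y = 2" using A by (simp add: y_def)
    have yi: "y $ i = z1 * (A1 $$ (i, 0) * x $ 0 + A1 $$ (i, 1) * x $ 1)
                    + z2 * (A2 $$ (i, 0) * x $ 0 + A2 $$ (i, 1) * x $ 1)" if "i < 2" for i
      using A x that by (simp add: y_def scalar_prod_def atLeast0LessThan sum_lessThan_2 algebra_simps)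
    have nX: "(norm X)\<^sup>2 = (vec_norm2 x)\<^sup>2"
      using x by (simp add: vec_norm2_dim2 norm_pair_power2 X_def)
    have nY: "(norm Y)\<^sup>2 = n\<^sup>2"
      using y by (simp add: n_def vec_norm2_dim2 norm_pair_power2 Y_def)
    have "z1 * bil A1 X Y + z2 * bil A2 X Y = cnj (y $ 0) * y $ 0 + cnj (y $ 1) * y $ 1"
      using yi[of 0] yi[of 1] by (simp add: bil_def X_def Y_def algebra_simps)
    also have "\<dots> = of_real (n\<^sup>2)"
      using y by (simp add: n_def vec_norm2_dim2 mult.commute flip: complex_norm_square)
    finally have "(n\<^sup>2)\<^sup>2 = (cmod (z1 * bil A1 X Y + z2 * bil A2 X Y))\<^sup>2"
      by (metis abs_power2 norm_of_real)
    also have "\<dots> \<le> (norm z)\<^sup>2 * bil_sq A1 A2 X Y"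
      using cmod_add_mult_le by (simp add: z norm_pair_power2 bil_sq_def)
    also have "\<dots> \<le> (norm z)\<^sup>2 * (m * (norm X)\<^sup>2 * (norm Y)\<^sup>2)"
      by (intro mult_left_mono le) simp
    also have "\<dots> \<le> (norm z)\<^sup>2 * (m * 1 * n\<^sup>2)"
      unfolding nX nY using m x1 by (intro mult_left_mono mult_right_mono) (auto simp: power_le_one)
    also have "\<dots> = (sqrt m * norm z)\<^sup>2 * n\<^sup>2" using m by (simp add: power_mult_distrib)
    finally have "n\<^sup>2 * n\<^sup>2 \<le> (sqrt m * norm z)\<^sup>2 * n\<^sup>2"
      by (simp only: power2_eq_square[of "n\<^sup>2"])
    then have "n\<^sup>2 \<le> (sqrt m * norm z)\<^sup>2 \<or> n = 0"
      by (metis mult_le_cancel_right not_less zero_less_power2)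
    then show "vec_norm2 ((z1 \<cdot>\<^sub>m A1 + z2 \<cdot>\<^sub>m A2) *\<^sub>v x) \<le> sqrt m * norm z"
      unfolding y_def[symmetric] n_def[symmetric]
      using m by (auto intro: power2_le_imp_le)
  qed
  then show ?thesis by (simp add: pair_norm_def z)
qed

section \<open>The dual norms\<close>

text \<open>List the entries of \<open>A1\<close> and \<open>A2\<close> as two columns: independence
  means rank two, hence some nonzero 2 by 2 minor.\<close>

lemma lin_indpt_pair_minor:
  assumes A: "A1 \<in> carrier_mat m n" "A2 \<in> carrier_mat m n" and ind: "lin_indpt_pair m n A1 A2"
  obtains i j k l where "i < m" "j < n" "k < m" "l < n"
    "A1 $$ (i, j) * A2 $$ (k, l) - A1 $$ (k, l) * A2 $$ (i, j) \<noteq> 0"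
proof -
  have "\<not> (1 \<cdot>\<^sub>m A1 + 0 \<cdot>\<^sub>m A2 = 0\<^sub>m m n)"
    using ind unfolding lin_indpt_pair_def by fastforce
  then obtain i j where ij: "i < m" "j < n" "A1 $$ (i, j) \<noteq> 0"
    using A by (auto simp: mat_eq_iff)
  \<comment> \<open>These coefficients cancel the entry at \<open>(i, j)\<close>. The combination is
    nontrivial because \<open>A1 $$ (i, j)\<close> is nonzero, and any nonzero entry of it is the
    desired minor up to sign.\<close>
  have "\<not> (A2 $$ (i, j) \<cdot>\<^sub>m A1 + (- A1 $$ (i, j)) \<cdot>\<^sub>m A2 = 0\<^sub>m m n)"
    using ind ij unfolding lin_indpt_pair_def by fastforce
  then obtain k l where "k < m" "l < n"
    "A2 $$ (i, j) * A1 $$ (k, l) - A1 $$ (i, j) * A2 $$ (k, l) \<noteq> 0"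
    using A by (auto simp: mat_eq_iff)
  with ij that show thesis by (auto simp: algebra_simps)
qed

text \<open>On the ball, every entry of \<open>z1 \<cdot>\<^sub>m A1 + z2 \<cdot>\<^sub>m A2\<close>
  has modulus at most 1. Two entries with nonzero minor \<open>D\<close> determine \<open>z1\<close>
  and \<open>z2\<close> by Cramer's rule, which bounds both.\<close>

lemma bdd_above_dual_norm:
  assumes A: "A1 \<in> carrier_mat m n" "A2 \<in> carrier_mat m n" and ind: "lin_indpt_pair m n A1 A2"
  shows "bdd_above ((\<lambda>(z1, z2). cmod (w1 * z1 + w2 * z2)) ` pair_ball A1 A2)"
proof -
  obtain i j k l where ijkl: "i < m" "j < n" "k < m" "l < n"
    and D: "A1 $$ (i, j) * A2 $$ (k, l) - A1 $$ (k, l) * A2 $$ (i, j) \<noteq> 0"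
    using lin_indpt_pair_minor[OF assms] .
  define a b c d where "a = A1 $$ (i, j)" "b = A2 $$ (i, j)" "c = A1 $$ (k, l)" "d = A2 $$ (k, l)"
  note abcd = this
  define D where "D = a * d - c * b"
  have D0: "D \<noteq> 0" using D by (simp add: D_def abcd)
  let ?B = "cmod w1 * ((cmod d + cmod b) / cmod D) + cmod w2 * ((cmod a + cmod c) / cmod D)"
  have "cmod (w1 * z1 + w2 * z2) \<le> ?B" if "(z1, z2) \<in> pair_ball A1 A2" for z1 z2
  proof -
    let ?N = "z1 \<cdot>\<^sub>m A1 + z2 \<cdot>\<^sub>m A2"
    have N: "op_norm ?N \<le> 1" using that by (simp add: pair_ball_def pair_norm_def)
    define r s where "r = z1 * a + z2 * b" "s = z1 * c + z2 * d"
    note rs = this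
    have r: "cmod r \<le> 1" using cmod_index_le_op_norm[of i ?N j] N ijkl A by (simp add: rs abcd)
    have s: "cmod s \<le> 1" using cmod_index_le_op_norm[of k ?N l] N ijkl A by (simp add: rs abcd)
    have bound: "cmod (p * r - q * s) / cmod D \<le> (cmod p + cmod q) / cmod D" for p q
    proof (rule divide_right_mono)
      have "cmod (p * r - q * s) \<le> cmod p * cmod r + cmod q * cmod s"
        by (metis norm_mult norm_triangle_ineq4)
      also have "\<dots> \<le> cmod p + cmod q" using r s by (intro add_mono mult_left_le) auto
      finally show "cmod (p * r - q * s) \<le> cmod p + cmod q" .
    qed simp
    have "z1 = (d * r - b * s) / D" "z2 = - ((c * r - a * s) / D)"
      using D0 by (simp_all add: rs D_def field_simps)
    then have "cmod z1 \<le> (cmod d + cmod b) / cmod D" "cmod z2 \<le> (cmod a + cmod c) / cmod D"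
      using bound[of d b] bound[of c a] by (simp_all add: norm_divide add.commute)
    then have "cmod w1 * cmod z1 + cmod w2 * cmod z2 \<le> ?B"
      by (intro add_mono mult_left_mono) auto
    moreover have "cmod (w1 * z1 + w2 * z2) \<le> cmod w1 * cmod z1 + cmod w2 * cmod z2"
      using norm_triangle_ineq[of "w1 * z1" "w2 * z2"] by (simp add: norm_mult)
    ultimately show ?thesis by linarith
  qed
  then show ?thesis by (intro bdd_aboveI2[where M = ?B]) auto
qed

text \<open>By \<open>le\<close>, the open Euclidean ball of radius \<open>c\<close> lies in
  \<open>pair_ball\<close>, and the supremum of |w1 z1 + w2 z2| over it is c |w|, approached in the
  direction of the conjugate of \<open>w\<close>. The factor \<open>t < 1\<close> keeps the test
  point inside the open ball.\<close>

lemma norm_le_dual_norm: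
  assumes A: "A1 \<in> carrier_mat m n" "A2 \<in> carrier_mat m n" and ind: "lin_indpt_pair m n A1 A2"
    and c: "0 < c" and le: "\<And>z. c * pair_norm A1 A2 z \<le> norm z"
  shows "c * norm w \<le> dual_norm A1 A2 w"
proof (rule field_le_mult_one_interval)
  fix t :: real assume t: "0 < t" "t < 1"
  obtain w1 w2 where w: "w = (w1, w2)" by fastforce
  \<comment> \<open>Scales the conjugate of \<open>w\<close> to length \<open>t * c\<close>. For
    \<open>w = 0\<close> the division yields \<open>s = 0\<close>, the test point is 0, and the
    estimates below still hold.\<close>
  define s where "s = complex_of_real (t * c / norm w)"
  define z1 z2 where "z1 = s * cnj w1" "z2 = s * cnj w2"
  note z = this
  have "(norm (z1, z2))\<^sup>2 = (cmod s * norm w)\<^sup>2"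
    by (simp add: norm_pair_power2 z w norm_mult power_mult_distrib algebra_simps)
  then have "norm (z1, z2) = cmod s * norm w"
    by (simp add: power2_eq_iff_nonneg)
  also have "\<dots> \<le> t * c" using t c by (simp add: s_def norm_divide norm_mult)
  finally have "c * pair_norm A1 A2 (z1, z2) \<le> t * c" using le[of "(z1, z2)"] by simp
  also have "\<dots> < c * 1" using t c by simp
  finally have ball: "(z1, z2) \<in> pair_ball A1 A2" using c by (simp add: pair_ball_def)
  have "w1 * z1 + w2 * z2 = s * of_real ((norm w)\<^sup>2)"
    by (simp add: z w norm_pair_power2 algebra_simps flip: complex_norm_square)
  then have "cmod (w1 * z1 + w2 * z2) = t * (c * norm w)"
    using t c by (simp add: s_def norm_mult norm_divide norm_power power2_eq_square)
  then have "t * (c * norm w) = (\<lambda>(z1, z2). cmod (w1 * z1 + w2 * z2)) (z1, z2)" by simp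
  also have "\<dots> \<le> dual_norm A1 A2 w"
    unfolding dual_norm_def w prod.case[of _ w1 w2]
    by (rule cSUP_upper[OF ball bdd_above_dual_norm[OF A ind]])
  finally show "t * (c * norm w) \<le> dual_norm A1 A2 w" .
qed

text \<open>On the pair \<open>(A1, A2)\<close> the quantity under the supremum is the very norm
  that is less than 1 on the ball. The ball contains 0, so the supremum is over a nonempty
  set.\<close>

lemma mat_dual_norm_self_le_1:
  assumes A: "A1 \<in> carrier_mat m n" "A2 \<in> carrier_mat m n"
  shows "mat_dual_norm A1 A2 (A1, A2) \<le> 1"
proof -
  have "0 \<cdot>\<^sub>m A1 + 0 \<cdot>\<^sub>m A2 = 0\<^sub>m m n" using A by (intro eq_matI) auto
  moreover have "op_norm (0\<^sub>m m n) \<le> 0"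
    by (rule op_norm_le) (simp add: vec_norm2_def L2_set_def)
  ultimately have "(0, 0) \<in> pair_ball A1 A2" by (simp add: pair_ball_def pair_norm_def)
  then have "pair_ball A1 A2 \<noteq> {}" by blast
  then show ?thesis
    unfolding mat_dual_norm_def prod.case
    by (rule cSUP_least) (auto simp: pair_ball_def pair_norm_def)
qed

section \<open>The row and column maps\<close>

definition col_mat :: "complex \<Rightarrow> complex \<Rightarrow> complex mat" where
  "col_mat a b = mat 2 1 (\<lambda>(i, j). if i = 0 then a else b)"

definition row_mat :: "complex \<Rightarrow> complex \<Rightarrow> complex mat" where
  "row_mat a b = mat 1 2 (\<lambda>(i, j). if j = 0 then a else b)"

lemma op_norm_col_mat_le: "op_norm (col_mat a b) \<le> norm (a, b)"
proof (rule op_norm_le)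
  fix x assume x: "x \<in> carrier_vec (dim_col (col_mat a b))" "vec_norm2 x \<le> 1"
  then have d: "dim_vec x = 1" by (simp add: col_mat_def)
  have "(vec_norm2 (col_mat a b *\<^sub>v x))\<^sup>2 = (norm (a, b) * vec_norm2 x)\<^sup>2"
    using d by (simp add: power_mult_distrib vec_norm2_power2 norm_pair_power2 col_mat_def
        scalar_prod_def atLeast0LessThan sum_lessThan_2 norm_mult algebra_simps)
  then have "vec_norm2 (col_mat a b *\<^sub>v x) = norm (a, b) * vec_norm2 x"
    by (simp add: power2_eq_iff_nonneg)
  also have "\<dots> \<le> norm (a, b)" using x by (simp add: mult_left_le)
  finally show "vec_norm2 (col_mat a b *\<^sub>v x) \<le> norm (a, b)" .
qed

text \<open>Cauchy-Schwarz. On scalars the row and the column thus obey the same Euclidean bound;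
  the two maps are told apart only by amplification.\<close>

lemma op_norm_row_mat_le: "op_norm (row_mat a b) \<le> norm (a, b)"
proof (rule op_norm_le)
  fix x assume x: "x \<in> carrier_vec (dim_col (row_mat a b))" "vec_norm2 x \<le> 1"
  then have d: "dim_vec x = 2" by (simp add: row_mat_def)
  have "(vec_norm2 (row_mat a b *\<^sub>v x))\<^sup>2 = (cmod (a * x $ 0 + b * x $ 1))\<^sup>2"
    using d by (simp add: vec_norm2_power2 row_mat_def scalar_prod_def atLeast0LessThan sum_lessThan_2)
  also have "\<dots> \<le> (norm (a, b) * vec_norm2 x)\<^sup>2"
    using cmod_add_mult_le d by (simp add: power_mult_distrib vec_norm2_dim2 norm_pair_power2)
  finally have "vec_norm2 (row_mat a b *\<^sub>v x) \<le> norm (a, b) * vec_norm2 x"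
    by (rule power2_le_imp_le) simp
  also have "\<dots> \<le> norm (a, b)" using x by (simp add: mult_left_le)
  finally show "vec_norm2 (row_mat a b *\<^sub>v x) \<le> norm (a, b)" .
qed

lemma smult_add_col_mat: "w1 \<cdot>\<^sub>m col_mat c 0 + w2 \<cdot>\<^sub>m col_mat 0 c = col_mat (c * w1) (c * w2)"
  by (intro eq_matI) (auto simp: col_mat_def)

lemma smult_add_row_mat: "w1 \<cdot>\<^sub>m row_mat c 0 + w2 \<cdot>\<^sub>m row_mat 0 c = row_mat (c * w1) (c * w2)"
  by (intro eq_matI) (auto simp: row_mat_def)

lemma norm_pair_smult: "0 \<le> c \<Longrightarrow> norm (complex_of_real c * a, complex_of_real c * b) = c * norm (a, b)"
  using norm_scaleR[of c "(a, b)"] by (simp add: scaleR_conv_of_real)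

lemma col_mat_contractive:
  assumes "0 \<le> c" "\<And>w. c * norm w \<le> dual_norm A1 A2 w"
  shows "contractive A1 A2 (col_mat (of_real c) 0) (col_mat 0 (of_real c))"
  unfolding contractive_def
proof
  fix w :: "complex \<times> complex"
  obtain w1 w2 where w: "w = (w1, w2)" by fastforce
  have "op_norm (lin_map (col_mat (of_real c) 0) (col_mat 0 (of_real c)) w) \<le> c * norm w"
    using op_norm_col_mat_le[of "of_real c * w1" "of_real c * w2"] assms(1)
    by (simp add: lin_map_def w smult_add_col_mat norm_pair_smult)
  also have "\<dots> \<le> dual_norm A1 A2 w" by (rule assms(2))
  finally show "op_norm (lin_map (col_mat (of_real c) 0) (col_mat 0 (of_real c)) w) \<le> dual_norm A1 A2 w" .
qed

lemma row_mat_contractive: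
  assumes "0 \<le> c" "\<And>w. c * norm w \<le> dual_norm A1 A2 w"
  shows "contractive A1 A2 (row_mat (of_real c) 0) (row_mat 0 (of_real c))"
  unfolding contractive_def
proof
  fix w :: "complex \<times> complex"
  obtain w1 w2 where w: "w = (w1, w2)" by fastforce
  have "op_norm (lin_map (row_mat (of_real c) 0) (row_mat 0 (of_real c)) w) \<le> c * norm w"
    using op_norm_row_mat_le[of "of_real c * w1" "of_real c * w2"] assms(1)
    by (simp add: lin_map_def w smult_add_row_mat norm_pair_smult)
  also have "\<dots> \<le> dual_norm A1 A2 w" by (rule assms(2))
  finally show "op_norm (lin_map (row_mat (of_real c) 0) (row_mat 0 (of_real c)) w) \<le> dual_norm A1 A2 w" .
qed

text \<open>The amplified matrix stacks \<open>c\<close> times the rows of \<open>A1\<close> and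
  \<open>A2\<close>, interleaved, so it sends \<open>u\<close> to a vector of squared length c^2
  (|A1 u|^2 + |A2 u|^2).\<close>

lemma op_norm_col_amplification:
  assumes A: "A1 \<in> carrier_mat 2 2" "A2 \<in> carrier_mat 2 2" and u: "norm u = 1" and c: "0 \<le> c"
    and le: "op_norm (A1 \<otimes>\<^sub>k col_mat (of_real c) 0 + A2 \<otimes>\<^sub>k col_mat 0 (of_real c)) \<le> 1"
  shows "c\<^sup>2 * ((cmod (bil A1 u (1, 0)))\<^sup>2 + (cmod (bil A1 u (0, 1)))\<^sup>2
     + (cmod (bil A2 u (1, 0)))\<^sup>2 + (cmod (bil A2 u (0, 1)))\<^sup>2) \<le> 1"
proof -
  define K where "K = A1 \<otimes>\<^sub>k col_mat (of_real c) 0 + A2 \<otimes>\<^sub>k col_mat 0 (of_real c)"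
  define x where "x = vec 2 (\<lambda>i. if i = 0 then fst u else snd u)"
  have K: "K \<in> carrier_mat 4 2" using A by (auto simp: K_def kronecker_mat_def col_mat_def)
  have "(vec_norm2 x)\<^sup>2 = (norm u)\<^sup>2" by (simp add: vec_norm2_dim2 x_def norm_pair_power2)
  from power2_eq_imp_eq[OF this] u have x1: "vec_norm2 x = 1" by simp
  have "vec_norm2 (K *\<^sub>v x) \<le> op_norm K * vec_norm2 x"
    using K by (intro vec_norm2_mult_mat_vec_le) (auto simp: x_def)
  then have "vec_norm2 (K *\<^sub>v x) \<le> 1" using le x1 by (simp add: K_def)
  then have "(vec_norm2 (K *\<^sub>v x))\<^sup>2 \<le> 1" by (simp add: power_le_one)
  moreover have "(vec_norm2 (K *\<^sub>v x))\<^sup>2 = (\<Sum>i<4. (cmod ((K *\<^sub>v x) $ i))\<^sup>2)"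
    using K by (simp add: vec_norm2_power2)
  moreover have "(K *\<^sub>v x) $ 0 = of_real c * bil A1 u (1, 0)" "(K *\<^sub>v x) $ 1 = of_real c * bil A2 u (1, 0)"
    "(K *\<^sub>v x) $ 2 = of_real c * bil A1 u (0, 1)" "(K *\<^sub>v x) $ 3 = of_real c * bil A2 u (0, 1)"
    using A by (simp_all add: K_def kronecker_mat_def col_mat_def scalar_prod_def x_def bil_def
        atLeast0LessThan sum_lessThan_2 algebra_simps)
  ultimately show ?thesis
    using c by (simp add: sum_lessThan_4 norm_mult power_mult_distrib algebra_simps)
qed

text \<open>The amplified matrix \<open>K\<close> lists \<open>c\<close> times the columns of
  \<open>A1\<close> and \<open>A2\<close>, interleaved, and the left side is the squared length of
  v^T K. To bound it without transposing, apply \<open>K\<close> to the conjugate \<open>x\<close>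
  of v^T K: with n = |x|^2 one gets n = v^T K x \<le> |K x| \<le> |x|, so n^2 \<le> n.\<close>

lemma op_norm_row_amplification:
  assumes A: "A1 \<in> carrier_mat 2 2" "A2 \<in> carrier_mat 2 2" and v: "norm v = 1" and c: "0 \<le> c"
    and le: "op_norm (A1 \<otimes>\<^sub>k row_mat (of_real c) 0 + A2 \<otimes>\<^sub>k row_mat 0 (of_real c)) \<le> 1"
  shows "c\<^sup>2 * ((cmod (bil A1 (1, 0) v))\<^sup>2 + (cmod (bil A1 (0, 1) v))\<^sup>2
     + (cmod (bil A2 (1, 0) v))\<^sup>2 + (cmod (bil A2 (0, 1) v))\<^sup>2) \<le> 1" (is "?l \<le> 1")
proof -
  define K where "K = A1 \<otimes>\<^sub>k row_mat (of_real c) 0 + A2 \<otimes>\<^sub>k row_mat 0 (of_real c)"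
  \<comment> \<open>The entries of v^T K divided by \<open>c\<close>, in the column order of the
    Kronecker product: the index of the matrix varies fastest.\<close>
  define b where "b i = (if i = 0 then bil A1 (1, 0) v else if i = 1 then bil A2 (1, 0) v
     else if i = 2 then bil A1 (0, 1) v else bil A2 (0, 1) v)" for i :: nat
  define x where "x = vec 4 (\<lambda>i. of_real c * cnj (b i))"
  define y where "y = K *\<^sub>v x"
  define n where "n = (vec_norm2 x)\<^sup>2"
  have K: "K \<in> carrier_mat 2 4" using A by (auto simp: K_def kronecker_mat_def row_mat_def)
  have y2: "dim_vec y = 2" using K by (simp add: y_def)
  have n: "n = ?l"
    by (simp add: n_def vec_norm2_power2 x_def b_def sum_lessThan_4 norm_mult power_mult_distrib algebra_simps)
  have "vec_norm2 y \<le> op_norm K * vec_norm2 x"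
    unfolding y_def using K by (intro vec_norm2_mult_mat_vec_le) (auto simp: x_def)
  also have "\<dots> \<le> vec_norm2 x" using mult_right_mono[OF le, of "vec_norm2 x"] by (simp add: K_def)
  finally have yx: "(vec_norm2 y)\<^sup>2 \<le> n" by (simp add: n_def power_mono)
  have "fst v * y $ 0 + snd v * y $ 1 = (\<Sum>i<4. of_real (c\<^sup>2) * (b i * cnj (b i)))"
    using A by (simp add: y_def K_def kronecker_mat_def row_mat_def scalar_prod_def x_def b_def bil_def
        atLeast0LessThan sum_lessThan_4 power2_eq_square algebra_simps)
  also have "\<dots> = of_real n"
    using c by (simp add: n_def vec_norm2_power2 x_def sum_lessThan_4 norm_mult power_mult_distrib
        algebra_simps flip: complex_norm_square)
  finally have "n\<^sup>2 = (cmod (fst v * y $ 0 + snd v * y $ 1))\<^sup>2" by simp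
  also have "\<dots> \<le> (norm v)\<^sup>2 * (vec_norm2 y)\<^sup>2"
    unfolding norm_pair_power2 vec_norm2_dim2[OF y2] by (rule cmod_add_mult_le)
  also have "\<dots> \<le> n" using v yx by simp
  finally have "n * n \<le> n" by (simp add: power2_eq_square)
  then have "n \<le> 1" using mult_strict_left_mono[of 1 n n] by (cases "1 < n") auto
  then show ?thesis by (simp only: n)
qed

section \<open>Unitary matrices and simultaneous diagonalization\<close>

lemma index_mat_adjoint:
  "i < dim_col A \<Longrightarrow> j < dim_row A \<Longrightarrow> mat_adjoint A $$ (i, j) = cnj (A $$ (j, i))"
  for A :: "complex mat"
  by (simp add: mat_adjoint_def mat_of_rows_def)

text \<open>The rows or the columns are the orthonormal pair \<open>(a, b)\<close>,
  \<open>(cnj b, - cnj a)\<close>. The disjunction serves both the matrix with these rows and the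
  one with these columns.\<close>

lemma unitary_mat_2:
  fixes U :: "complex mat"
  assumes "U \<in> carrier_mat 2 2" "(cmod a)\<^sup>2 + (cmod b)\<^sup>2 = 1"
    and "U $$ (0, 0) = a" "U $$ (1, 1) = - cnj a"
    and "U $$ (0, 1) = b \<and> U $$ (1, 0) = cnj b \<or> U $$ (0, 1) = cnj b \<and> U $$ (1, 0) = b"
  shows "unitary_mat U"
proof -
  have "a * cnj a + b * cnj b = 1"
    using assms(2) by (metis complex_norm_square of_real_1 of_real_add)
  then have e: "a * cnj a + b * cnj b = 1" "b * cnj b + a * cnj a = 1" by (simp_all add: add.commute)
  have d: "dim_row (mat_adjoint U) = 2" "dim_col (mat_adjoint U) = 2"
    using assms(1) by (auto simp: mat_adjoint_def)
  have "U * mat_adjoint U = 1\<^sub>m 2" "mat_adjoint U * U = 1\<^sub>m 2"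
    using assms(1,3,4,5) e d
    by (auto intro!: eq_matI simp: scalar_prod_def atLeast0LessThan sum_lessThan_2 index_mat_adjoint
        less_2_cases_iff mult.commute)
  then show ?thesis using assms(1) by (auto simp: unitary_mat_def)
qed

text \<open>\<open>u'\<close> and \<open>v'\<close> complete \<open>u\<close> and \<open>v\<close>
  to orthonormal bases. With rows \<open>v\<close>, \<open>v'\<close> in \<open>U\<close> and
  columns \<open>u\<close>, \<open>u'\<close> in \<open>W\<close>, the entries of
  \<open>U * B * W\<close> are values of \<open>bil B\<close>, and the hypotheses \<open>b\<close>
  kill the off-diagonal ones.\<close>

lemma simultaneously_diagonalizableI:
  assumes A: "A1 \<in> carrier_mat 2 2" "A2 \<in> carrier_mat 2 2" and u: "norm u = 1" and v: "norm v = 1"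
    and u': "u' = (cnj (snd u), - cnj (fst u))" and v': "v' = (cnj (snd v), - cnj (fst v))"
    and b: "bil A1 u v' = 0" "bil A2 u v' = 0" "bil A1 u' v = 0" "bil A2 u' v = 0"
  shows "simultaneously_diagonalizable 2 A1 A2"
proof -
  define U where "U = mat 2 2 (\<lambda>(i, j). let w = (if i = 0 then v else v') in if j = 0 then fst w else snd w)"
  define W where "W = mat 2 2 (\<lambda>(i, j). let w = (if j = 0 then u else u') in if i = 0 then fst w else snd w)"
  have UW: "U \<in> carrier_mat 2 2" "W \<in> carrier_mat 2 2" by (simp_all add: U_def W_def)
  have "unitary_mat U" using v norm_pair_power2[of v]
    by (intro unitary_mat_2[of _ "fst v" "snd v"]) (auto simp: U_def v')
  moreover have "unitary_mat W" using u norm_pair_power2[of u]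
    by (intro unitary_mat_2[of _ "fst u" "snd u"]) (auto simp: W_def u')
  moreover have "diagonal_mat (U * B * W)"
    if "B \<in> carrier_mat 2 2" "bil B u v' = 0" "bil B u' v = 0" for B
  proof -
    have "(U * B * W) $$ (i, j) = bil B (if j = 0 then u else u') (if i = 0 then v else v')"
      if "i < 2" "j < 2" for i j
      using that \<open>B \<in> carrier_mat 2 2\<close> by (auto simp: U_def W_def bil_def scalar_prod_def
          atLeast0LessThan sum_lessThan_2 algebra_simps)
    then show ?thesis using that UW by (auto simp: diagonal_mat_def less_2_cases_iff)
  qed
  ultimately show ?thesis
    using A UW b unfolding simultaneously_diagonalizable_def by blast
qed

section \<open>Contradiction from the column and row maps\<close>

theorem mainTheorem1:
  fixes A1 A2 :: "complex mat"
  assumes "A1 \<in> carrier_mat 2 2" and "A2 \<in> carrier_mat 2 2"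
    and "lin_indpt_pair 2 2 A1 A2"
    and "\<not> simultaneously_diagonalizable 2 A1 A2"
  shows "\<exists>p q V1 V2. p > 0 \<and> q > 0 \<and> V1 \<in> carrier_mat p q \<and> V2 \<in> carrier_mat p q \<and>
           contractive A1 A2 V1 V2 \<and> \<not> completely_contractive A1 A2 V1 V2"
proof (rule ccontr)
  assume no: "\<not> ?thesis"
  note A = assms(1,2)
  obtain u v where u: "norm u = 1" and v: "norm v = 1"
    and max: "\<And>x y. bil_sq A1 A2 x y \<le> bil_sq A1 A2 u v * (norm x)\<^sup>2 * (norm y)\<^sup>2"
    by (rule bil_sq_attains_max) blast
  define m where "m = bil_sq A1 A2 u v"
  \<comment> \<open>A zero maximum would make \<open>bil A1\<close> vanish on the standard basis, so
    \<open>A1\<close> would be zero, against independence.\<close>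
  have "m \<noteq> 0"
  proof
    assume "m = 0"
    then have "bil_sq A1 A2 x y \<le> 0" for x y using max[of x y] by (simp add: m_def)
    then have bil0: "bil A1 x y = 0" for x y
      unfolding bil_sq_def
      by (metis norm_eq_zero order_antisym sum_power2_ge_zero sum_power2_eq_zero_iff)
    have "1 \<cdot>\<^sub>m A1 + 0 \<cdot>\<^sub>m A2 = 0\<^sub>m 2 2"
      using A bil0[of "(1, 0)" "(1, 0)"] bil0[of "(1, 0)" "(0, 1)"]
        bil0[of "(0, 1)" "(1, 0)"] bil0[of "(0, 1)" "(0, 1)"]
      by (intro eq_matI) (auto simp: bil_def less_2_cases_iff)
    then show False using assms(3) unfolding lin_indpt_pair_def by fastforce
  qed
  then have m: "0 < m" by (simp add: m_def bil_sq_def less_le)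
  define c where "c = 1 / sqrt m"
  have c: "0 < c" and c2: "c\<^sup>2 = 1 / m" using m by (simp_all add: c_def power_divide)
  have "c * pair_norm A1 A2 z \<le> norm z" for z
    using pair_norm_le[OF A, of m z] m max by (simp add: c_def m_def field_simps)
  then have dual: "c * norm w \<le> dual_norm A1 A2 w" for w
    by (rule norm_le_dual_norm[OF A assms(3) c])
  \<comment> \<open>Under the assumption \<open>no\<close>, every contractive pair is completely
    contractive; level \<open>k = 2\<close> is applied to the test pair
    \<open>(A1, A2)\<close>.\<close>
  have ampl: "op_norm (A1 \<otimes>\<^sub>k V1 + A2 \<otimes>\<^sub>k V2) \<le> 1"
    if "p > 0" "q > 0" "V1 \<in> carrier_mat p q" "V2 \<in> carrier_mat p q" "contractive A1 A2 V1 V2"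
    for p q V1 V2
  proof -
    have "completely_contractive A1 A2 V1 V2" using no that by blast
    then have "op_norm (lin_map_ampl V1 V2 (A1, A2)) \<le> mat_dual_norm A1 A2 (A1, A2)"
      using A unfolding completely_contractive_def by (metis one_le_numeral)
    then show ?thesis using mat_dual_norm_self_le_1[OF A] by (simp add: lin_map_ampl_def)
  qed
  define u' v' where "u' = (cnj (snd u), - cnj (fst u))" "v' = (cnj (snd v), - cnj (fst v))"
  note uv' = this
  \<comment> \<open>Parseval: both sides are |B u|^2, on the left in the basis given by
    \<open>v\<close> and \<open>v'\<close>. The fact \<open>row\<close> is the analogue for v^T B
    and the basis \<open>u\<close>, \<open>u'\<close>.\<close>
  have col: "(cmod (bil B u v))\<^sup>2 + (cmod (bil B u v'))\<^sup>2
      = (cmod (bil B u (1, 0)))\<^sup>2 + (cmod (bil B u (0, 1)))\<^sup>2" for B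
  proof -
    have "bil B u v = fst v * bil B u (1, 0) + snd v * bil B u (0, 1)"
      "bil B u v' = bil B u (1, 0) * cnj (snd v) - bil B u (0, 1) * cnj (fst v)"
      by (simp_all add: bil_def uv' algebra_simps)
    then show ?thesis
      using v norm_pair_power2[of v] by (simp add: cmod_add_mult_power2)
  qed
  have row: "(cmod (bil B u v))\<^sup>2 + (cmod (bil B u' v))\<^sup>2
      = (cmod (bil B (1, 0) v))\<^sup>2 + (cmod (bil B (0, 1) v))\<^sup>2" for B
  proof -
    have "bil B u v = fst u * bil B (1, 0) v + snd u * bil B (0, 1) v"
      "bil B u' v = bil B (1, 0) v * cnj (snd u) - bil B (0, 1) v * cnj (fst u)"
      by (simp_all add: bil_def uv' algebra_simps)
    then show ?thesis
      using u norm_pair_power2[of u] by (simp add: cmod_add_mult_power2)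
  qed
  have "op_norm (A1 \<otimes>\<^sub>k col_mat (of_real c) 0 + A2 \<otimes>\<^sub>k col_mat 0 (of_real c)) \<le> 1"
    using c dual by (intro ampl[of 2 1] col_mat_contractive) (auto simp: col_mat_def)
  from op_norm_col_amplification[OF A u _ this] c
  \<comment> \<open>The column bound is |A1 u|^2 + |A2 u|^2 \<le> 1 / c^2 = m. By \<open>col\<close>
    the left side already contains the maximal value \<open>m\<close>, leaving nothing for the
    \<open>v'\<close> components; the row map does the same for \<open>u'\<close>.\<close>
  have "bil_sq A1 A2 u v' + m \<le> m"
    using col[of A1] col[of A2] m by (simp add: c2 field_simps m_def bil_sq_def)
  moreover have "op_norm (A1 \<otimes>\<^sub>k row_mat (of_real c) 0 + A2 \<otimes>\<^sub>k row_mat 0 (of_real c)) \<le> 1"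
    using c dual by (intro ampl[of 1 2] row_mat_contractive) (auto simp: row_mat_def)
  from op_norm_row_amplification[OF A v _ this] c
  have "bil_sq A1 A2 u' v + m \<le> m"
    using row[of A1] row[of A2] m by (simp add: c2 field_simps m_def bil_sq_def)
  ultimately have "bil A1 u v' = 0" "bil A2 u v' = 0" "bil A1 u' v = 0" "bil A2 u' v = 0"
    by (simp_all add: bil_sq_def sum_power2_le_zero_iff)
  then show False
    using simultaneously_diagonalizableI[OF A u v uv'] assms(4) by simp
qed

end
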